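(* Let $n$ be odd, $k$ a positive integer with $\gcd(k,n)=1$, $q=2^k$, and define $$\Phi(m)=\frac{m+m^{q}+m^{q^{2}}}{m^{\,q^{2}-q+1}}\qquad(m\in\mathbb{F}_{2^n}^{*}).$$ Then: (i) The map $b\mapsto m(b):=(x+y)^{-(q+1)}$, where $x=b^{1/(q+1)}$ and $y=(b+1)^{1/(q+1)}$, is exactly $2$-to-$1$ from $\mathbb{F}_{2^n}$ onto $H_1$, with fibers $\{b,b+1\}$, and $$F(b)+F(b+1)=\Phi\bigl(m(b)\bigr)\qquad\text{for all } b\in\mathbb{F}_{2^n}.$$ (ii) $\Phi$ restricted to $H_1$ is a bijection onto $\Delta+1=\{t+1:t\in\Delta\}$. (iii) For every $a\in\mathbb{F}_{2^n}$, $$S(a)=\chi(a)\sum_{m\in H_1}\chi\bigl(a\,\Phi(m)\bigr).$$ (iv) The statement "$|\{(x,y,z)\in\Delta^3: v_1x+v_2y+(v_1+v_2)z=0\}|=2^{2n-3}$ for all distinct nonzero $v_1,v_2\in\mathbb{F}_{2^n}$" is equivalent to: for all $\rho\in\mathbb{F}_{2^n}\setminus\{0,1\}$, with $\sigma=1+\rho$, $$\bigl|\{(m_1,m_2,m_3)\in H_1^3:\ \Phi(m_1)+\rho\,\Phi(m_2)+\sigma\,\Phi(m_3)=0\}\bigr|=2^{2n-3}.$$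
   Context: $\mathbb{F}_{2^n}$ is the field with $2^n$ elements, $\operatorname{Tr}(x)=\sum_{i=0}^{n-1}x^{2^i}$ is the absolute trace, $\chi(x)=(-1)^{\operatorname{Tr}(x)}$, and $H_1=\{x\in\mathbb{F}_{2^n}:\operatorname{Tr}(x)=1\}$. Put $F(x)=x^{4^k-2^k+1}=x^{q^2-q+1}$, $\delta(b)=F(b)+F(b+1)+1$, $\Delta=\{\delta(b): b\in\mathbb{F}_{2^n}\}$, and $S(a)=\sum_{t\in\Delta}\chi(at)$. For $n$ odd and $\gcd(k,n)=1$ one has $\gcd(q+1,2^n-1)=1$, so $x\mapsto x^{q+1}$ is a permutation of $\mathbb{F}_{2^n}$; $b^{1/(q+1)}$ denotes the image of $b$ under the inverse permutation. *)

theory Defs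
  imports "HOL-Computational_Algebra.Computational_Algebra"
begin

text \<open>
  The field with \<open>2 ^ n\<close> elements is a type of class \<open>finite_field\<close> with
  \<open>2 ^ n\<close> elements; since \<open>n\<close> is not part of the type, it is passed explicitly where needed.
\<close>

definition abs_trace :: "nat \<Rightarrow> 'a::finite_field \<Rightarrow> 'a" where
  "abs_trace n x = (\<Sum>i<n. x ^ (2 ^ i))"

(* Over the field with 2 ^ n elements the trace takes only the values 0 and 1 of the prime field,
   so this is (-1) to the power of the trace. *)
definition chi :: "nat \<Rightarrow> 'a::finite_field \<Rightarrow> int" where
  "chi n x = (if abs_trace n x = 0 then 1 else -1)"

definition H1 :: "nat \<Rightarrow> 'a::finite_field set" where
  "H1 n = {x. abs_trace n x = 1}"

definition F :: "nat \<Rightarrow> 'a::finite_field \<Rightarrow> 'a" where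
  "F k x = x ^ (4 ^ k - 2 ^ k + 1)"

definition delta :: "nat \<Rightarrow> 'a::finite_field \<Rightarrow> 'a" where
  "delta k b = F k b + F k (b + 1) + 1"

definition Delta :: "nat \<Rightarrow> 'a::finite_field set" where
  "Delta k = range (delta k)"

definition S :: "nat \<Rightarrow> nat \<Rightarrow> 'a::finite_field \<Rightarrow> int" where
  "S n k a = (\<Sum>t\<in>Delta k. chi n (a * t))"

(* Only meaningful for nonzero arguments; at 0 it has the value 0 by the convention x / 0 = 0. *)
definition Phi :: "nat \<Rightarrow> 'a::finite_field \<Rightarrow> 'a" where
  "Phi q m = (m + m ^ q + m ^ (q\<^sup>2)) / m ^ (q\<^sup>2 - q + 1)"

(* b to the power 1 / (q + 1); only meaningful when the (q + 1)-th power map is a permutation,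
   as it is for q = 2 ^ k, n odd and coprime k n. *)
definition qp1_root :: "nat \<Rightarrow> 'a::finite_field \<Rightarrow> 'a" where
  "qp1_root q b = inv (\<lambda>x. x ^ (q + 1)) b"

definition mmap :: "nat \<Rightarrow> 'a::finite_field \<Rightarrow> 'a" where
  "mmap q b = inverse ((qp1_root q b + qp1_root q (b + 1)) ^ (q + 1))"

end

theory Submission
  imports Defs
begin

text \<open>
  Writing \<open>x = b ^ (1 / (q + 1))\<close> as \<open>u s\<close> with \<open>s = x + y\<close>, the relation \<open>x ^ (q + 1) + y ^ (q + 1) = 1\<close> becomes
  \<open>u ^ q + u + 1 = m\<close> with \<open>m = m(b)\<close>, so \<open>m\<close> has trace \<open>1\<close>. It determines \<open>u\<close> up to adding \<open>1\<close>,
  which amounts to exchanging \<open>b\<close> and \<open>b + 1\<close>, and surjectivity onto \<open>H\<^sub>1\<close> follows by counting.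
  For the injectivity of \<open>\<Phi>\<close>, put \<open>w = m ^ (1 - q)\<close>: then \<open>\<Phi> m = c\<close> reads
  \<open>w ^ (q + 1) + w ^ q + 1 = c w\<close>. If \<open>w' \<noteq> w\<close> is a second root of this equation, then
  \<open>Y = m (w + 1) / (w + w')\<close> satisfies \<open>Y ^ q + Y = m\<close>, which forces \<open>m\<close> to have trace \<open>0\<close>.
\<close>

section \<open>Characteristic 2 and fixed points of Frobenius powers\<close>

locale kasami =
  fixes n k q :: nat and field_type :: "'a::finite_field itself"
  assumes card_field: "card (UNIV :: 'a set) = 2 ^ n"
    and odd_n: "odd n"
    and coprime_kn: "coprime k n"
    and q_eq: "q = 2 ^ k"
begin

lemma frob_n: "(x :: 'a) ^ (2 ^ n) = x"
  using finite_field_power_card_eq_same[of x] card_field by simp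

text \<open>As \<open>2 ^ n\<close> is even, raising -1 to that power gives 1, while
  \<open>frob_n\<close> gives -1.\<close>

lemma CHAR_2: "CHAR('a) = 2"
proof -
  have "even ((2::nat) ^ n)"
    using odd_n by (cases n) auto
  hence "(-1 :: 'a) = 1"
    using frob_n[of "-1"] by simp
  hence "of_nat 2 = (0 :: 'a)"
    by (metis add.left_inverse of_nat_1 of_nat_add one_add_one)
  hence "CHAR('a) dvd 2"
    by (simp only: of_nat_eq_0_iff_char_dvd)
  thus ?thesis
    using CHAR_not_1[where 'a = 'a] two_is_prime_nat prime_nat_iff by (metis One_nat_def)
qed

lemma add_self [simp]: "(x :: 'a) + x = 0"
  using minus_CHAR_2[OF CHAR_2, of x x] by simp

lemma add_self_left [simp]: "(x :: 'a) + (x + y) = y"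
  by (simp flip: add.assoc)

lemma add_eq_0_iff_eq: "(x :: 'a) + y = 0 \<longleftrightarrow> x = y"
  using minus_CHAR_2[OF CHAR_2, of x y] by (metis right_minus_eq)

lemma frob_add: "((x :: 'a) + y) ^ (2 ^ j) = x ^ (2 ^ j) + y ^ (2 ^ j)"
  by (rule freshmans_dream') (simp_all add: CHAR_2)

lemma q_add: "((x :: 'a) + y) ^ q = x ^ q + y ^ q"
  by (simp add: q_eq frob_add)

lemma frob_fixed_mult:
  assumes "(x :: 'a) ^ (2 ^ j) = x"
  shows "x ^ (2 ^ (j * i)) = x"
proof (induction i)
  case (Suc i)
  have "x ^ (2 ^ (j * Suc i)) = (x ^ (2 ^ j)) ^ (2 ^ (j * i))"
    by (simp add: power_add flip: power_mult)
  thus ?case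
    using assms Suc by simp
qed simp

text \<open>By Bezout some multiple of \<open>j\<close> is 1 modulo \<open>n\<close>; iterating the
  \<open>j\<close>-th Frobenius that often is squaring, so \<open>x\<close> equals its own
  square.\<close>

lemma frob_fixed:
  assumes "(x :: 'a) ^ (2 ^ j) = x" and "coprime j n"
  shows "x = 0 \<or> x = 1"
proof (cases "j = 0")
  \<comment> \<open>\<open>bezout_nat\<close> needs \<open>j\<close> nonzero; \<open>j = 0\<close>
    is coprime only to \<open>n = 1\<close>, where \<open>frob_n\<close> itself is the squaring
    relation.\<close>
  case True
  hence "n = 1"
    using assms by simp
  hence "x * (x - 1) = 0"
    using frob_n[of x] by (simp add: power2_eq_square algebra_simps)
  thus ?thesis
    by auto
next
  case False
  then obtain a b where "j * a = n * b + 1"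
    using bezout_nat[of j n] assms(2) by auto
  hence "x = (x ^ (2 ^ (n * b))) ^ 2"
    using frob_fixed_mult[OF assms(1), of a] by (metis power_add power_mult power_one_right)
  also have "\<dots> = x ^ 2"
    using frob_fixed_mult[OF frob_n, of x b] by simp
  finally have "x * (x - 1) = 0"
    by (simp add: power2_eq_square algebra_simps)
  thus ?thesis
    by auto
qed

lemma q_fixed: "(x :: 'a) ^ q = x \<Longrightarrow> x = 0 \<or> x = 1"
  using frob_fixed[of x k] coprime_kn by (simp add: q_eq)

section \<open>The permutation given by the power q + 1\<close>

text \<open>The quotient \<open>z\<close> of two elements with equal image satisfies
  \<open>z ^ q = 1 / z\<close>, so it is fixed by the Frobenius power \<open>2 * k\<close>. This is
  coprime to \<open>n\<close> because \<open>n\<close> is odd, which leaves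
  \<open>z = 1\<close>.\<close>

lemma inj_gold: "inj (\<lambda>x :: 'a. x ^ (q + 1))"
proof (rule injI)
  fix x y :: 'a
  assume eq: "x ^ (q + 1) = y ^ (q + 1)"
  show "x = y"
  proof (cases "y = 0")
    case True
    thus ?thesis using eq by auto
  next
    case False
    define z where "z = x / y"
    have z: "z * z ^ q = 1"
      using eq False by (simp add: z_def power_divide)
    hence z0: "z \<noteq> 0" by auto
    have "(z * z ^ q) ^ q = 1"
      by (simp add: z)
    hence "z ^ q * z ^ (q ^ 2) = 1"
      by (simp add: power_mult_distrib power2_eq_square power_mult)
    hence "z ^ (q ^ 2) = z"
      using z by (metis mult.left_commute mult.right_neutral)
    moreover have "q ^ 2 = 2 ^ (2 * k)"
      by (simp add: q_eq power_mult mult.commute)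
    ultimately have "z ^ (2 ^ (2 * k)) = z"
      by simp
    moreover have "coprime (2 * k) n"
      using odd_n coprime_kn by simp
    ultimately have "z = 1"
      using frob_fixed z0 by blast
    thus ?thesis
      using False by (simp add: z_def)
  qed
qed

lemma qp1_root_power: "qp1_root q (b :: 'a) ^ (q + 1) = b"
proof -
  have "surj (\<lambda>x :: 'a. x ^ (q + 1))"
    using inj_gold by (simp add: finite_UNIV_inj_surj)
  thus ?thesis
    unfolding qp1_root_def by (rule surj_f_inv_f)
qed

section \<open>The absolute trace and the set H1\<close>

lemma trace_add: "abs_trace n (x + y :: 'a) = abs_trace n x + abs_trace n y"
  by (simp add: abs_trace_def frob_add sum.distrib)

text \<open>Squaring permutes the summands cyclically, since \<open>x ^ (2 ^ n) = x\<close>.\<close>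

lemma trace_square: "abs_trace n ((x :: 'a) ^ 2) = abs_trace n x"
proof -
  have "x + abs_trace n (x ^ 2) = (\<Sum>i<Suc n. x ^ (2 ^ i))"
    by (subst sum.lessThan_Suc_shift) (simp add: abs_trace_def flip: power_mult)
  also have "\<dots> = x + abs_trace n x"
    by (simp add: abs_trace_def frob_n add.commute)
  finally show ?thesis
    by simp
qed

lemma trace_frob: "abs_trace n ((x :: 'a) ^ (2 ^ j)) = abs_trace n x"
proof (induction j)
  case (Suc j)
  have "abs_trace n (x ^ (2 ^ Suc j)) = abs_trace n ((x ^ (2 ^ j)) ^ 2)"
    by (simp add: mult.commute flip: power_mult)
  thus ?case
    using Suc by (simp only: trace_square)
qed simp

lemma trace_cases: "abs_trace n (x :: 'a) = 0 \<or> abs_trace n x = 1"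
proof -
  have "abs_trace n x ^ 2 = abs_trace n (x ^ 2)"
    unfolding abs_trace_def
    by (subst freshmans_dream_sum) (simp_all add: CHAR_2 mult.commute flip: power_mult)
  hence "abs_trace n x ^ 2 = abs_trace n x"
    by (simp only: trace_square)
  hence "abs_trace n x * (abs_trace n x - 1) = 0"
    by (simp add: power2_eq_square algebra_simps)
  thus ?thesis
    by auto
qed

lemma trace_1: "abs_trace n (1 :: 'a) = 1"
proof -
  have "abs_trace n (1 :: 'a) = of_nat n"
    by (simp add: abs_trace_def)
  also have "\<dots> \<noteq> 0"
    using odd_n by (simp add: of_nat_eq_0_iff_char_dvd CHAR_2)
  finally show ?thesis
    using trace_cases by blast
qed

lemma trace_0: "abs_trace n (0 :: 'a) = 0"
  using trace_add[of 0 0] by simp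

lemma trace_artin_schreier: "abs_trace n ((u :: 'a) ^ q + u) = 0"
  by (simp add: trace_add trace_frob q_eq)

lemma chi_add: "chi n (x + y :: 'a) = chi n x * chi n y"
  using trace_cases[of x] trace_cases[of y] by (auto simp: chi_def trace_add)

lemma H1_nonzero: "(m :: 'a) \<in> H1 n \<Longrightarrow> m \<noteq> 0"
  by (auto simp: H1_def trace_0)

text \<open>The trace of 1 is 1, so the translate of \<open>H1 n\<close> by 1 is disjoint from it
  and of equal size.\<close>

lemma card_H1_le: "2 * card (H1 n :: 'a set) \<le> 2 ^ n"
proof -
  have disj: "H1 n \<inter> (\<lambda>x. x + 1) ` (H1 n :: 'a set) = {}"
    by (auto simp: H1_def trace_add trace_1)
  have "2 * card (H1 n :: 'a set) = card (H1 n :: 'a set) + card ((\<lambda>x. x + 1) ` (H1 n :: 'a set))"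
    by (subst card_image) auto
  also have "\<dots> = card (H1 n \<union> (\<lambda>x. x + 1) ` (H1 n :: 'a set))"
    by (rule card_Un_disjoint[symmetric]) (use disj in auto)
  also have "\<dots> \<le> card (UNIV :: 'a set)"
    by (rule card_mono) auto
  finally show ?thesis
    by (simp add: card_field)
qed

section \<open>The map m(b), its fibers and its image\<close>

text \<open>Normalizing by \<open>s = x + y\<close> replaces the two roots by one parameter
  \<open>u\<close> with an Artin-Schreier equation, from which trace, fibers and the formula for
  \<open>F\<close> are all read off.\<close>

lemma mmap_param:
  fixes b :: 'a
  obtains u where "mmap q b \<noteq> 0" and "u ^ q + u = mmap q b + 1"
    and "b = u ^ (q + 1) / mmap q b"
proof -
  define x y where "x = qp1_root q b" and "y = qp1_root q (b + 1)"
  define s where "s = x + y"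
  define u where "u = x / s"
  have x: "x ^ (q + 1) = b" and y: "y ^ (q + 1) = b + 1"
    unfolding x_def y_def by (rule qp1_root_power)+
  have m: "mmap q b = inverse (s ^ (q + 1))"
    by (simp add: mmap_def s_def x_def y_def)
  have s0: "s \<noteq> 0"
  proof
    assume "s = 0"
    hence "x = y" by (simp add: s_def add_eq_0_iff_eq)
    thus False using x y by simp
  qed
  have xu: "x = u * s" and yu: "y = (u + 1) * s"
  proof -
    show "x = u * s" using s0 by (simp add: u_def)
    hence "(u + 1) * s = x + (x + y)" by (simp add: distrib_right s_def)
    thus "y = (u + 1) * s" by simp
  qed
  have bu: "b = u ^ (q + 1) / mmap q b"
    using x by (simp add: m xu power_mult_distrib divide_inverse mult_ac)
  have "(u + 1) ^ (q + 1) / mmap q b = b + 1"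
    using y by (simp add: m yu power_mult_distrib divide_inverse mult_ac)
  hence "(u + 1) ^ (q + 1) / mmap q b = u ^ (q + 1) / mmap q b + 1"
    by (simp only: flip: bu)
  moreover have m0: "mmap q b \<noteq> 0"
    using s0 by (simp add: m)
  ultimately have "(u + 1) ^ (q + 1) = u ^ (q + 1) + mmap q b"
    by (simp add: divide_simps)
  hence "u ^ (q + 1) + (u ^ q + u + 1) = u ^ (q + 1) + mmap q b"
    by (simp add: q_add algebra_simps)
  hence "u ^ q + u + 1 = mmap q b"
    by (metis add_left_imp_eq)
  hence "u ^ q + u = mmap q b + 1"
    by (metis add.assoc add.right_neutral add_self)
  thus ?thesis
    using that m0 bu by blast
qed

lemma mmap_in_H1: "mmap q (b :: 'a) \<in> H1 n"
proof -
  obtain u where "u ^ q + u = mmap q b + 1"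
    using mmap_param[of b] .
  hence "abs_trace n (mmap q b + 1) = 0"
    using trace_artin_schreier by metis
  thus ?thesis
    by (simp add: H1_def trace_add trace_1 add_eq_0_iff_eq)
qed

text \<open>Passing from \<open>u\<close> to \<open>u + 1\<close> keeps the Artin-Schreier equation
  and exchanges the roles of \<open>x\<close> and \<open>y\<close>.\<close>

lemma succ_param:
  fixes b m u :: 'a
  assumes "m \<noteq> 0" and "u ^ q + u = m + 1" and "b = u ^ (q + 1) / m"
  shows "b + 1 = (u + 1) ^ (q + 1) / m"
proof -
  have "(u + 1) ^ (q + 1) = u ^ (q + 1) + (u ^ q + u) + 1"
    by (simp add: q_add algebra_simps)
  also have "\<dots> = u ^ (q + 1) + m"
    by (simp add: assms(2) add.assoc)
  finally show ?thesis
    using assms by (simp add: add_divide_distrib)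
qed

text \<open>Two parameters for the same value differ by an element fixed under the power
  \<open>q\<close>, hence by 0 or 1.\<close>

lemma mmap_fiber: "{c :: 'a. mmap q c = mmap q b} = {b, b + 1}"
proof (intro equalityI subsetI)
  fix c :: 'a
  assume "c \<in> {c. mmap q c = mmap q b}"
  hence eq: "mmap q c = mmap q b" by simp
  obtain u where u: "mmap q b \<noteq> 0" "u ^ q + u = mmap q b + 1" "b = u ^ (q + 1) / mmap q b"
    using mmap_param .
  obtain v where v: "v ^ q + v = mmap q b + 1" "c = v ^ (q + 1) / mmap q b"
    using mmap_param[of c] unfolding eq by metis
  have "(u + v) ^ q + (u + v) = (u ^ q + u) + (v ^ q + v)"
    by (simp add: q_add algebra_simps)
  hence "(u + v) ^ q = u + v"
    unfolding u(2) v(1) by (simp only: add_self add_eq_0_iff_eq)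
  hence "u + v = 0 \<or> u + v = 1"
    by (rule q_fixed)
  hence "v = u \<or> v = u + 1"
    by (metis add_eq_0_iff_eq add_self_left)
  thus "c \<in> {b, b + 1}"
    using u(3) v(2) succ_param[OF u] by auto
next
  fix c
  assume "c \<in> {b, b + 1}"
  thus "c \<in> {c. mmap q c = mmap q b}"
    by (auto simp: mmap_def add.commute add.assoc)
qed

lemma card_mmap_fiber: "card {c :: 'a. mmap q c = mmap q b} = 2"
  by (simp add: mmap_fiber)

text \<open>Fibers of size 2 give the image half the field, and \<open>H1 n\<close>, which contains
  it, is no larger.\<close>

lemma range_mmap: "range (mmap q) = (H1 n :: 'a set)"
proof (rule card_subset_eq)
  have "2 ^ n = card (UNIV :: 'a set)"
    by (simp add: card_field)
  also have "(UNIV :: 'a set) = (\<Union>m\<in>range (mmap q). {b. mmap q b = m})"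
    by auto
  also have "card \<dots> = (\<Sum>m\<in>range (mmap q). card {b :: 'a. mmap q b = m})"
    by (rule card_UN_disjoint) auto
  also have "\<dots> = 2 * card (range (mmap q) :: 'a set)"
  proof -
    have "card {b :: 'a. mmap q b = m} = 2" if "m \<in> range (mmap q)" for m :: 'a
      using that card_mmap_fiber by blast
    thus ?thesis
      by simp
  qed
  finally have "2 * card (H1 n :: 'a set) \<le> 2 * card (range (mmap q) :: 'a set)"
    using card_H1_le by simp
  moreover have "card (range (mmap q) :: 'a set) \<le> card (H1 n :: 'a set)"
    by (rule card_mono) (auto simp: mmap_in_H1)
  ultimately show "card (range (mmap q) :: 'a set) = card (H1 n :: 'a set)"
    by simp
qed (auto simp: mmap_in_H1)

section \<open>The sum F(b) + F(b + 1) as a value of Phi\<close>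

lemma F_eq: "F k (x :: 'a) = x ^ (q\<^sup>2 - q + 1)"
proof -
  have "(4 :: nat) ^ k = q\<^sup>2"
    by (simp add: q_eq power2_eq_square flip: power_mult_distrib)
  thus ?thesis
    by (simp add: F_def q_eq)
qed

lemma F_sum_eq_Phi: "F k b + F k (b + 1) = Phi q (mmap q (b :: 'a))"
proof -
  define m where "m = mmap q b"
  obtain u where u: "m \<noteq> 0" "u ^ q + u = m + 1" "b = u ^ (q + 1) / m"
    using mmap_param unfolding m_def .
  have "q \<le> q\<^sup>2"
    by (simp add: power2_eq_square)
  \<comment> \<open>The factorization of \<open>q ^ 3 + 1\<close> is checked over the integers to
    avoid truncated subtraction.\<close>
  hence "int ((q + 1) * (q\<^sup>2 - q + 1)) = int (q ^ 3 + 1)"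
    by (simp add: of_nat_diff algebra_simps power2_eq_square power3_eq_cube)
  hence e: "(q + 1) * (q\<^sup>2 - q + 1) = q ^ 3 + 1"
    by (simp only: of_nat_eq_iff)
  have Fdiv: "F k (x ^ (q + 1) / m) = x ^ (q ^ 3 + 1) / m ^ (q\<^sup>2 - q + 1)" for x
    unfolding F_eq power_divide power_mult[symmetric] e ..
  have cube: "x ^ (q ^ 3) = ((x ^ q) ^ q) ^ q" for x :: 'a
    by (simp add: power3_eq_cube power_mult)
  have sq: "x ^ (q\<^sup>2) = (x ^ q) ^ q" for x :: 'a
    by (simp add: power2_eq_square power_mult)
  have uq: "u ^ q = u + (m + 1)"
    using u(2) by (metis add.commute add_self_left)
  have "u ^ (q ^ 3 + 1) + (u + 1) ^ (q ^ 3 + 1) = u ^ (q ^ 3) + u + 1"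
    by (simp add: cube q_add algebra_simps)
  \<comment> \<open>Applying \<open>uq\<close> three times telescopes \<open>u ^ (q ^ 3) + u\<close>
    to the sum of the q-conjugates of \<open>m + 1\<close>; with the extra 1 there are four ones,
    which cancel.\<close>
  also have "\<dots> = m + m ^ q + m ^ (q\<^sup>2)"
    by (simp add: cube sq q_add uq add_ac)
  finally show ?thesis
    unfolding Phi_def m_def[symmetric] succ_param[OF u]
    by (subst u(3)) (simp only: Fdiv flip: add_divide_distrib)
qed

section \<open>Injectivity of Phi on H1\<close>

text \<open>With \<open>M\<close> and \<open>N\<close> the next two q-conjugates of
  \<open>m\<close>, both sides equal \<open>(m + M + N) / N\<close>.\<close>

lemma Phi_eq:
  fixes m :: 'a
  assumes "m \<noteq> 0"
  defines "w \<equiv> m / m ^ q"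
  shows "w * w ^ q + w ^ q + 1 = Phi q m * w"
proof -
  define M N where "M = m ^ q" and "N = M ^ q"
  have [simp]: "M \<noteq> 0" "N \<noteq> 0"
    using assms by (simp_all add: M_def N_def)
  have N: "m ^ (q\<^sup>2) = N"
    by (simp add: M_def N_def power2_eq_square power_mult)
  have "q \<le> q\<^sup>2"
    by (simp add: power2_eq_square)
  hence "m ^ (q\<^sup>2 - q + 1) * M = m ^ (q\<^sup>2 + 1)"
    unfolding M_def by (simp flip: power_add)
  hence "m ^ (q\<^sup>2 - q + 1) = N * m / M"
    by (simp add: N field_simps)
  hence Phi: "Phi q m = (m + M + N) / (N * m / M)"
    unfolding Phi_def N M_def[symmetric] by simp
  have w: "w = m / M" and wq: "w ^ q = M / N"
    by (simp_all add: w_def M_def N_def power_divide)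
  show ?thesis
    unfolding Phi wq unfolding w using assms(1) by (simp add: field_simps)
qed

text \<open>The quotient \<open>m / m'\<close> is fixed under the power \<open>q\<close>, hence 1.
  So distinct \<open>m\<close> yield distinct roots \<open>w\<close>.\<close>

lemma inj_ratio:
  fixes m m' :: 'a
  assumes "m \<noteq> 0" and "m' \<noteq> 0" and "m / m ^ q = m' / m' ^ q"
  shows "m = m'"
proof -
  have "(m / m') ^ q = m / m'"
    using assms by (simp add: power_divide field_simps)
  hence "m / m' = 1"
    using q_fixed[of "m / m'"] assms by auto
  thus ?thesis
    using assms by simp
qed

lemma inj_on_Phi: "inj_on (Phi q) (H1 n :: 'a set)"
proof (rule inj_onI, rule ccontr)
  fix m m' :: 'a
  assume H: "m \<in> H1 n" "m' \<in> H1 n" and eq: "Phi q m = Phi q m'" and neq: "m \<noteq> m'"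
  have m0: "m \<noteq> 0" "m' \<noteq> 0"
    using H H1_nonzero by auto
  define w w' where "w = m / m ^ q" and "w' = m' / m' ^ q"
  define W W' where "W = w ^ q" and "W' = w' ^ q"
  define t where "t = w + w'"
  have w0: "w \<noteq> 0"
    using m0 by (simp add: w_def)
  have "w \<noteq> w'"
    using inj_ratio[of m m'] m0 neq by (auto simp: w_def w'_def)
  hence t0: "t \<noteq> 0"
    by (simp add: t_def add_eq_0_iff_eq)
  have tq: "t ^ q = W + W'"
    by (simp add: t_def q_add W_def W'_def)
  hence T0: "W + W' \<noteq> 0"
    using t0 by (metis power_eq_0_iff)
  have "w * W + W + 1 = Phi q m * w" "w' * W' + W' + 1 = Phi q m * w'"
    using Phi_eq[OF m0(1)] Phi_eq[OF m0(2)] by (simp_all add: eq w_def w'_def W_def W'_def)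
  \<comment> \<open>Cross-multiplying eliminates the common value of \<open>Phi\<close>.\<close>
  hence "w' * (w * W + W + 1) = w * (w' * W' + W' + 1)"
    by simp
  hence E: "w' * (w * W + W + 1) + w * (w' * W' + W' + 1) = 0"
    by (simp only: add_self)
  have "(W + 1) * t + (w + 1) * w * (W + W') =
      w * (W + W') * t + (w' * (w * W + W + 1) + w * (w' * W' + W' + 1))"
    by (simp add: t_def algebra_simps)
  hence key: "(W + 1) * t + (w + 1) * w * (W + W') = w * (W + W') * t"
    unfolding E by simp
  \<comment> \<open>Dividing \<open>key\<close> by \<open>w * (W + W') * t\<close> and multiplying
    by \<open>m\<close> leaves two terms with sum \<open>m\<close>. As \<open>m / w = m ^ q\<close>,
    one is the q-th power of the other; that other term is \<open>Y\<close>.\<close>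
  define Y where "Y = m * (w + 1) / t"
  have mq: "m ^ q = m / w"
    using m0 by (simp add: w_def)
  have "Y ^ q = m / w * (W + 1) / (W + W')"
    by (simp add: Y_def power_divide power_mult_distrib q_add tq mq W_def)
  hence "Y ^ q + Y = m / (w * (W + W') * t) * ((W + 1) * t + (w + 1) * w * (W + W'))"
    using w0 t0 T0 by (simp add: Y_def divide_simps) (simp add: algebra_simps)
  also have "\<dots> = m"
    unfolding key using w0 t0 T0 by simp
  finally have "abs_trace n m = 0"
    using trace_artin_schreier by metis
  thus False
    using H by (simp add: H1_def)
qed

section \<open>Delta, the sum S(a) and the triple counts\<close>

lemma Delta_eq: "Delta k = (\<lambda>m. Phi q m + 1) ` (H1 n :: 'a set)"
  by (auto simp: Delta_def delta_def F_sum_eq_Phi image_image simp flip: range_mmap)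

lemma bij_betw_Phi_Delta: "bij_betw (\<lambda>m. Phi q m + 1) (H1 n :: 'a set) (Delta k)"
  using inj_on_Phi unfolding bij_betw_def Delta_eq by (auto simp: inj_on_def)

lemma bij_betw_Phi: "bij_betw (Phi q) (H1 n :: 'a set) {t + 1 | t. t \<in> Delta k}"
proof -
  have "{t + 1 | t. t \<in> Delta k} = Phi q ` (H1 n :: 'a set)"
    unfolding Delta_eq by (force simp: add.assoc)
  thus ?thesis
    using inj_on_Phi by (simp add: bij_betw_def)
qed

lemma S_eq: "S n k (a :: 'a) = chi n a * (\<Sum>m\<in>H1 n. chi n (a * Phi q m))"
proof -
  have "S n k a = (\<Sum>m\<in>H1 n. chi n (a * (Phi q m + 1)))"
    unfolding S_def by (rule sum.reindex_bij_betw[OF bij_betw_Phi_Delta, symmetric])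
  also have "\<dots> = (\<Sum>m\<in>H1 n. chi n a * chi n (a * Phi q m))"
    by (simp add: distrib_left chi_add mult.commute)
  finally show ?thesis
    by (simp add: sum_distrib_left)
qed

text \<open>The coefficients sum to \<open>0\<close>, so the shift by \<open>1\<close> between \<open>\<Delta>\<close> and \<open>\<Phi> ` H\<^sub>1\<close> cancels.\<close>

lemma card_Delta_triples:
  fixes v1 v2 :: 'a
  assumes "v1 \<noteq> 0"
  shows "card {(x, y, z). x \<in> Delta k \<and> y \<in> Delta k \<and> z \<in> Delta k \<and>
            v1 * x + v2 * y + (v1 + v2) * z = 0} =
         card {(m1, m2, m3). m1 \<in> H1 n \<and> m2 \<in> H1 n \<and> m3 \<in> H1 n \<and>
            Phi q m1 + v2 / v1 * Phi q m2 + (1 + v2 / v1) * Phi q m3 = 0}"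
    (is "card ?D = card ?M")
proof -
  let ?g = "\<lambda>m. Phi q m + 1 :: 'a"
  let ?G = "\<lambda>(m1, m2, m3). (?g m1, ?g m2, ?g m3)"
  have equation: "v1 * ?g x + v2 * ?g y + (v1 + v2) * ?g z = 0 \<longleftrightarrow>
      Phi q x + v2 / v1 * Phi q y + (1 + v2 / v1) * Phi q z = 0" for x y z
  proof -
    have "v1 * ?g x + v2 * ?g y + (v1 + v2) * ?g z =
        v1 * Phi q x + v2 * Phi q y + (v1 + v2) * Phi q z"
      by (simp add: algebra_simps)
    also have "\<dots> = v1 * (Phi q x + v2 / v1 * Phi q y + (1 + v2 / v1) * Phi q z)"
      using assms by (simp add: field_simps)
    finally show ?thesis
      using assms by simp
  qed
  have "inj_on ?G ?M"
    using bij_betw_imp_inj_on[OF bij_betw_Phi_Delta] by (auto simp: inj_on_def)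
  moreover have "?G ` ?M = ?D"
  proof (intro equalityI subsetI)
    fix p assume "p \<in> ?G ` ?M"
    thus "p \<in> ?D"
      by (auto simp: Delta_eq equation)
  next
    fix p assume "p \<in> ?D"
    then obtain m1 m2 m3 where "m1 \<in> H1 n" "m2 \<in> H1 n" "m3 \<in> H1 n"
      "p = (?g m1, ?g m2, ?g m3)" "v1 * ?g m1 + v2 * ?g m2 + (v1 + v2) * ?g m3 = 0"
      by (auto simp: Delta_eq)
    thus "p \<in> ?G ` ?M"
      unfolding equation by (intro image_eqI[of _ _ "(m1, m2, m3)"]) auto
  qed
  ultimately show ?thesis
    by (metis (no_types, lifting) card_image)
qed

text \<open>The count depends on \<open>v1\<close>, \<open>v2\<close> only through \<rho> =
  \<open>v2 / v1\<close>, and every \<rho> arises with \<open>v1 = 1\<close>. Since \<open>N\<close>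
  is arbitrary, truncation of \<open>2 * n - 3\<close> at \<open>n = 1\<close> is harmless.\<close>

lemma triples_equiv:
  fixes N :: nat
  shows "(\<forall>v1 v2 :: 'a. v1 \<noteq> 0 \<and> v2 \<noteq> 0 \<and> v1 \<noteq> v2 \<longrightarrow>
           card {(x, y, z). x \<in> Delta k \<and> y \<in> Delta k \<and> z \<in> Delta k \<and>
                   v1 * x + v2 * y + (v1 + v2) * z = 0} = N)
        \<longleftrightarrow>
        (\<forall>\<rho> \<sigma> :: 'a. \<rho> \<noteq> 0 \<and> \<rho> \<noteq> 1 \<and> \<sigma> = 1 + \<rho> \<longrightarrow>
           card {(m1, m2, m3). m1 \<in> H1 n \<and> m2 \<in> H1 n \<and> m3 \<in> H1 n \<and>
                   Phi q m1 + \<rho> * Phi q m2 + \<sigma> * Phi q m3 = 0} = N)"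
    (is "?L \<longleftrightarrow> ?R")
proof
  assume L: ?L
  show ?R
  proof (intro allI impI, elim conjE)
    fix \<rho> \<sigma> :: 'a
    assume "\<rho> \<noteq> 0" "\<rho> \<noteq> 1" "\<sigma> = 1 + \<rho>"
    thus "card {(m1, m2, m3). m1 \<in> H1 n \<and> m2 \<in> H1 n \<and> m3 \<in> H1 n \<and>
                   Phi q m1 + \<rho> * Phi q m2 + \<sigma> * Phi q m3 = 0} = N"
      using L[rule_format, of 1 \<rho>] card_Delta_triples[of 1 \<rho>] by simp
  qed
next
  assume R: ?R
  show ?L
  proof (intro allI impI, elim conjE)
    fix v1 v2 :: 'a
    assume v: "v1 \<noteq> 0" "v2 \<noteq> 0" "v1 \<noteq> v2"
    hence "v2 / v1 \<noteq> 0" "v2 / v1 \<noteq> 1"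
      by simp_all
    thus "card {(x, y, z). x \<in> Delta k \<and> y \<in> Delta k \<and> z \<in> Delta k \<and>
                   v1 * x + v2 * y + (v1 + v2) * z = 0} = N"
      unfolding card_Delta_triples[OF v(1)] using R by blast
  qed
qed

end

theorem theorem10p1:
  fixes n k q :: nat
  assumes card_field: "card (UNIV :: 'a::finite_field set) = 2 ^ n"
    and "odd n" and "k > 0" and "coprime k n" and "q = 2 ^ k"
  shows
    "(range (mmap q) = (H1 n :: 'a set) \<and>
      (\<forall>m \<in> (H1 n :: 'a set). card {b. mmap q b = m} = 2) \<and>
      (\<forall>b :: 'a. {c. mmap q c = mmap q b} = {b, b + 1}) \<and>
      (\<forall>b :: 'a. F k b + F k (b + 1) = Phi q (mmap q b)))
     \<and> bij_betw (Phi q) (H1 n :: 'a set) {t + 1 | t. t \<in> Delta k}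
     \<and> (\<forall>a :: 'a. S n k a = chi n a * (\<Sum>m\<in>H1 n. chi n (a * Phi q m)))
     \<and> ((\<forall>v1 v2 :: 'a. v1 \<noteq> 0 \<and> v2 \<noteq> 0 \<and> v1 \<noteq> v2 \<longrightarrow>
           card {(x, y, z). x \<in> Delta k \<and> y \<in> Delta k \<and> z \<in> Delta k \<and>
                   v1 * x + v2 * y + (v1 + v2) * z = 0} = 2 ^ (2 * n - 3))
        \<longleftrightarrow>
        (\<forall>\<rho> \<sigma> :: 'a. \<rho> \<noteq> 0 \<and> \<rho> \<noteq> 1 \<and> \<sigma> = 1 + \<rho> \<longrightarrow>
           card {(m1, m2, m3). m1 \<in> H1 n \<and> m2 \<in> H1 n \<and> m3 \<in> H1 n \<and>
                   Phi q m1 + \<rho> * Phi q m2 + \<sigma> * Phi q m3 = 0} = 2 ^ (2 * n - 3)))"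
proof -
  interpret kasami n k q "TYPE('a)"
    using assms by unfold_locales
  have "card {b :: 'a. mmap q b = m} = 2" if "m \<in> H1 n" for m :: 'a
    using that card_mmap_fiber by (auto simp flip: range_mmap)
  thus ?thesis
    by (intro conjI ballI allI range_mmap mmap_fiber F_sum_eq_Phi bij_betw_Phi S_eq triples_equiv)
qed

end
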